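(* If $X$ is a Urysohn SDL topological space, then $|X| \leq 2^{\chi(X)}$.
   Context: A space is Urysohn if any two distinct points have open neighbourhoods with disjoint closures. A space is Lindelöf if every open cover has a countable subcover. A subset $D$ of a topological space $X$ is strongly discrete if for every $x \in D$ there is an open neighbourhood $U_x \subset X$ of $x$ such that $U_x\cap U_y=\emptyset$ for distinct $x,y\in D$. A space $X$ is SDL if the closure in $X$ of every strongly discrete subset of $X$ is Lindelöf. $\chi(X)$ is the character of $X$: the least infinite cardinal $\kappa$ such that every point of $X$ has a local base of cardinality at most $\kappa$. *)

theory Defs
  imports "HOL-Analysis.Lindelof_Spaces"
begin

unbundle cardinal_syntax

definition Urysohn_space :: "'a topology \<Rightarrow> bool" where
  "Urysohn_space X \<longleftrightarrow>
     (\<forall>x\<in>topspace X. \<forall>y\<in>topspace X. x \<noteq> y \<longrightarrow>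
        (\<exists>U V. openin X U \<and> openin X V \<and> x \<in> U \<and> y \<in> V \<and>
               X closure_of U \<inter> X closure_of V = {}))"

definition strongly_discrete :: "'a topology \<Rightarrow> 'a set \<Rightarrow> bool" where
  "strongly_discrete X D \<longleftrightarrow>
     D \<subseteq> topspace X \<and>
     (\<exists>U. (\<forall>x\<in>D. openin X (U x) \<and> x \<in> U x) \<and>
          (\<forall>x\<in>D. \<forall>y\<in>D. x \<noteq> y \<longrightarrow> U x \<inter> U y = {}))"

definition SDL_space :: "'a topology \<Rightarrow> bool" where
  "SDL_space X \<longleftrightarrow>
     (\<forall>D. strongly_discrete X D \<longrightarrow> Lindelof_space (subtopology X (X closure_of D)))"

definition local_base :: "'a topology \<Rightarrow> 'a \<Rightarrow> 'a set set \<Rightarrow> bool" where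
  "local_base X x \<B> \<longleftrightarrow>
     (\<forall>V\<in>\<B>. openin X V \<and> x \<in> V) \<and>
     (\<forall>U. openin X U \<and> x \<in> U \<longrightarrow> (\<exists>V\<in>\<B>. V \<subseteq> U))"

definition character_bound :: "'a topology \<Rightarrow> 'k rel \<Rightarrow> bool" where
  "character_bound X \<kappa> \<longleftrightarrow>
     Cinfinite \<kappa> \<and> (\<forall>x\<in>topspace X. \<exists>\<B>. local_base X x \<B> \<and> |\<B>| \<le>o \<kappa>)"

text \<open>
  Cardinals are cardinal well-orders, unique only up to \<open>=o\<close>, so \<open>character X\<close> is a choice of a
  least bound. The type \<^typ>\<open>(nat + 'a set) rel\<close> has room for both \<open>\<aleph>\<^sub>0\<close> and every local base;
  \<open>character_least\<close> below shows that minimality holds against cardinals on arbitrary types.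
\<close>
definition character :: "'a topology \<Rightarrow> (nat + 'a set) rel" where
  "character X =
     (SOME \<kappa>. character_bound X \<kappa> \<and>
        (\<forall>\<kappa>' :: (nat + 'a set) rel. character_bound X \<kappa>' \<longrightarrow> \<kappa> \<le>o \<kappa>'))"

lemma character_bound_UNIV: "character_bound X |UNIV :: (nat + 'a set) set|"
  for X :: "'a topology"
proof -
  have "|\<B>| \<le>o |UNIV :: (nat + 'a set) set|" for \<B> :: "'a set set"
    by (intro card_of_ordLeqI[where f = Inr]) auto
  moreover have "local_base X x {U. openin X U \<and> x \<in> U}" for x
    by (auto simp: local_base_def)
  ultimately show ?thesis
    unfolding character_bound_def cinfinite_def
    by (metis Field_card_of card_of_Card_order finite_Plus_UNIV_iff infinite_UNIV_nat)
qed

lemma character_minimal: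
  fixes X :: "'a topology"
  shows "character_bound X (character X) \<and>
     (\<forall>\<kappa> :: (nat + 'a set) rel. character_bound X \<kappa> \<longrightarrow> character X \<le>o \<kappa>)"
  unfolding character_def
proof (rule someI_ex)
  have "\<exists>r \<in> {r :: (nat + 'a set) rel. character_bound X r}.
          \<forall>r' \<in> {r :: (nat + 'a set) rel. character_bound X r}. r \<le>o r'"
    by (rule exists_minim_Card_order)
      (use character_bound_UNIV[of X] in \<open>auto simp: character_bound_def\<close>)
  then show "\<exists>\<kappa> :: (nat + 'a set) rel. character_bound X \<kappa> \<and>
      (\<forall>\<kappa>' :: (nat + 'a set) rel. character_bound X \<kappa>' \<longrightarrow> \<kappa> \<le>o \<kappa>')"
    by blast
qed

lemma character_bound_character: "character_bound X (character X)"
  using character_minimal by blast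

lemma character_bound_cong:
  assumes "\<kappa> =o \<kappa>'" "character_bound X \<kappa>"
  shows "character_bound X \<kappa>'"
  using assms unfolding character_bound_def
  by (meson Cinfinite_cong ordLeq_ordIso_trans)

lemma character_least:
  fixes X :: "'a topology" and \<kappa> :: "'k rel"
  assumes "character_bound X \<kappa>"
  shows "character X \<le>o \<kappa>"
proof (cases "|UNIV :: (nat + 'a set) set| \<le>o \<kappa>")
  case True
  then show ?thesis
    using character_minimal[of X] character_bound_UNIV[of X] ordLeq_transitive by blast
next
  case False
  have co: "Card_order \<kappa>"
    using assms by (simp add: character_bound_def)
  then have iso: "|Field \<kappa>| =o \<kappa>"
    by (rule card_of_Field_ordIso)
  from False co have "\<kappa> \<le>o |UNIV :: (nat + 'a set) set|"
    by (metis card_of_Well_order card_order_on_def ordLeq_total)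
  with iso have "|Field \<kappa>| \<le>o |UNIV :: (nat + 'a set) set|"
    using ordIso_ordLeq_trans by blast
  then obtain f :: "'k \<Rightarrow> nat + 'a set" where "inj_on f (Field \<kappa>)"
    using card_of_ordLeq[of "Field \<kappa>" "UNIV :: (nat + 'a set) set"] by blast
  then have "|Field \<kappa>| =o |f ` Field \<kappa>|"
    by (intro card_of_ordIsoI[where f = f] inj_on_imp_bij_betw)
  with iso have eq: "\<kappa> =o |f ` Field \<kappa>|"
    using ordIso_symmetric ordIso_transitive by blast
  then have "character X \<le>o |f ` Field \<kappa>|"
    using assms character_minimal[of X] character_bound_cong by blast
  with eq show ?thesis
    using ordIso_symmetric ordLeq_ordIso_trans by blast
qed

end

theory Submission
  imports Defs
begin

text \<open>
  Let \<open>\<kappa>\<close> be the character of \<open>X\<close>. Given a closed set \<open>H\<close> and an open neighbourhood \<open>V x\<close> of each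
  \<open>x \<in> H\<close>, some \<open>\<kappa>\<close> many of the \<open>V x\<close> have a union whose closure contains \<open>H\<close>. Otherwise choose points
  \<open>x i \<in> H\<close> for \<open>i < \<kappa>\<^sup>+\<close>, each outside the closure of a union \<open>W i\<close> of \<open>\<kappa>\<close> many \<open>V x\<close> that contains
  \<open>V (x j)\<close> and \<open>W j\<close> for all \<open>j < i\<close> as well as the closure of \<open>{x j | j < i}\<close>; the latter is possible
  because this set is strongly discrete, so that its closure is Lindeloef. The set of all \<open>x i\<close> is
  again strongly discrete, and as \<open>\<kappa>\<^sup>+\<close> is regular its closure is covered by the increasing
  family \<open>W i\<close>, hence by a single \<open>W i\<close>, which contradicts \<open>x i \<notin> W i\<close>.

  Now let \<open>H\<close> have cardinality at most \<open>2^\<kappa>\<close> and be closed under \<open>\<theta>\<close>-closures of subsets of size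
  \<open>\<kappa>\<close> and under choosing a point outside the closure of the union of \<open>\<kappa>\<close> many basic neighbourhoods
  of its points. If \<open>z \<notin> H\<close>, then \<open>z\<close> has a neighbourhood \<open>G\<close> with closure disjoint from \<open>H\<close>, and
  the basic neighbourhoods of points of \<open>H\<close> that avoid \<open>G\<close> lead to a contradiction with the above.
\<close>

section \<open>Cardinal arithmetic\<close>

text \<open>Excluding the empty set makes every member an image of
  \<open>Field \<kappa>\<close>.\<close>

definition small_subsets :: "'k rel \<Rightarrow> 'a set \<Rightarrow> 'a set set" where
  "small_subsets \<kappa> M = {S. S \<subseteq> M \<and> S \<noteq> {} \<and> |S| \<le>o \<kappa>}"

lemma Cinfinite_ctwo_cexp: "Cinfinite \<kappa> \<Longrightarrow> Cinfinite (ctwo ^c \<kappa>)"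
  by (intro Cinfinite_cexp ordLeq_refl Card_order_ctwo)

lemma ordLeq_ctwo_cexp: "Card_order \<kappa> \<Longrightarrow> r \<le>o \<kappa> \<Longrightarrow> r \<le>o ctwo ^c \<kappa>"
  using ordLess_ctwo_cexp ordLeq_transitive ordLess_imp_ordLeq by blast

lemma card_of_image_ordLeq: "|A| \<le>o r \<Longrightarrow> |f ` A| \<le>o r"
  using card_of_image ordLeq_transitive by blast

lemma card_of_subset_ordLeq: "A \<subseteq> B \<Longrightarrow> |B| \<le>o r \<Longrightarrow> |A| \<le>o r"
  using card_of_mono1 ordLeq_transitive by blast

lemma card_of_countable_ordLeq:
  assumes "countable A" "Cinfinite r"
  shows "|A| \<le>o r"
proof -
  have "|A| \<le>o |UNIV :: nat set|"
    using assms(1) by (auto simp: countable_def intro: card_of_ordLeqI)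
  also have "|UNIV :: nat set| \<le>o r"
    using assms(2) natLeq_ordLeq_cinfinite card_of_nat ordIso_ordLeq_trans by blast
  finally show ?thesis .
qed

lemma card_of_singleton_ordLeq: "Cinfinite r \<Longrightarrow> |{x}| \<le>o r"
  by (intro card_of_countable_ordLeq countable_finite) auto

text \<open>Each such set is the range of a function from \<open>Field \<kappa>\<close> to
  \<open>M\<close>, and \<open>(ctwo ^c \<kappa>) ^c \<kappa> =o ctwo ^c \<kappa>\<close>.\<close>

lemma card_of_small_subsets:
  assumes \<kappa>: "Cinfinite \<kappa>" and M: "|M| \<le>o ctwo ^c \<kappa>"
  shows "|small_subsets \<kappa> M| \<le>o ctwo ^c \<kappa>"
proof -
  have co: "Card_order \<kappa>"
    using \<kappa> by simp
  have "small_subsets \<kappa> M \<subseteq> (\<lambda>f. f ` Field \<kappa>) ` Func (Field \<kappa>) M"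
  proof
    fix S assume S: "S \<in> small_subsets \<kappa> M"
    then have "|S| \<le>o |Field \<kappa>|"
      unfolding small_subsets_def
      using card_of_Field_ordIso[OF co] ordIso_symmetric ordLeq_ordIso_trans by blast
    then obtain g where g: "g ` Field \<kappa> = S"
      using S card_of_ordLeq2[of S "Field \<kappa>"] unfolding small_subsets_def by blast
    let ?f = "\<lambda>k. if k \<in> Field \<kappa> then g k else undefined"
    have "?f \<in> Func (Field \<kappa>) M"
      using g S by (auto simp: Func_def small_subsets_def)
    moreover have "S = ?f ` Field \<kappa>"
      using g by auto
    ultimately show "S \<in> (\<lambda>f. f ` Field \<kappa>) ` Func (Field \<kappa>) M"
      by blast
  qed
  then have "|small_subsets \<kappa> M| \<le>o |Func (Field \<kappa>) M|"
    by (rule surj_imp_ordLeq)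
  also have "|Func (Field \<kappa>) M| =o |M| ^c \<kappa>"
    by (simp add: cexp_def Field_card_of card_of_refl)
  also have "|M| ^c \<kappa> \<le>o (ctwo ^c \<kappa>) ^c \<kappa>"
    using M co by (rule cexp_mono1)
  also have "(ctwo ^c \<kappa>) ^c \<kappa> =o ctwo ^c \<kappa>"
    using \<kappa> by (intro cexp_cprod_ordLeq Card_order_ctwo ordLeq_refl Cinfinite_Cnotzero) auto
  finally show ?thesis .
qed

section \<open>Recursion along a successor cardinal\<close>

text \<open>\<open>G\<close> sees only the set of earlier values, not their indices, so whatever
  later stages need must be stored in the values.\<close>

lemma underS_recursion:
  assumes "Well_order r"
  shows "\<exists>F. \<forall>i. F i = G (F ` underS r i)"
proof -
  have "wf (r - Id)"
    using assms by (simp add: well_order_on_def)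
  moreover have "adm_wf (r - Id) (\<lambda>F i. G (F ` underS r i))"
    unfolding adm_wf_def underS_def by (intro allI impI arg_cong[where f = G] image_cong) auto
  ultimately show ?thesis
    using wfrec_fixpoint by (metis (no_types, lifting))
qed

lemma Well_order_cardSuc: "Card_order \<kappa> \<Longrightarrow> Well_order (cardSuc \<kappa>)"
  by (rule card_order_on_well_order_on[OF cardSuc_Card_order])

lemma underS_cardSuc:
  assumes "Cinfinite \<kappa>" "i \<in> Field (cardSuc \<kappa>)"
  shows "|underS (cardSuc \<kappa>) i| \<le>o \<kappa>"
proof -
  have "|underS (cardSuc \<kappa>) i| <o cardSuc \<kappa>"
    using assms by (intro card_of_underS cardSuc_Card_order) auto
  then show ?thesis
    using assms(1) by (simp add: cardSuc_ordLeq_ordLess card_of_Card_order)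
qed

lemma underS_mono_cardSuc:
  assumes "Card_order \<kappa>" "(i, j) \<in> cardSuc \<kappa>"
  shows "underS (cardSuc \<kappa>) i \<subseteq> underS (cardSuc \<kappa>) j"
proof -
  have "Well_order (cardSuc \<kappa>)"
    using assms(1) by (rule Well_order_cardSuc)
  then show ?thesis
    using assms(2) unfolding underS_def well_order_on_def linear_order_on_def partial_order_on_def
      preorder_on_def trans_def antisym_def by blast
qed

lemma underS_linear_cardSuc:
  assumes "Card_order \<kappa>" "i \<in> Field (cardSuc \<kappa>)" "j \<in> Field (cardSuc \<kappa>)" "i \<noteq> j"
  shows "i \<in> underS (cardSuc \<kappa>) j \<or> j \<in> underS (cardSuc \<kappa>) i"
proof -
  have "Well_order (cardSuc \<kappa>)"
    using assms(1) by (rule Well_order_cardSuc)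
  then show ?thesis
    using assms unfolding underS_def well_order_on_def linear_order_on_def total_on_def by blast
qed

text \<open>Regularity of the successor cardinal, applied to the chain of its initial segments;
  these cover the field because an infinite cardinal has no last element.\<close>

lemma cardSuc_bounded:
  assumes \<kappa>: "Cinfinite \<kappa>" and J: "J \<subseteq> Field (cardSuc \<kappa>)" "|J| \<le>o \<kappa>"
  shows "\<exists>i\<in>Field (cardSuc \<kappa>). J \<subseteq> underS (cardSuc \<kappa>) i"
proof (rule cardSuc_UNION_Cinfinite[OF \<kappa>])
  show "relChain (cardSuc \<kappa>) (underS (cardSuc \<kappa>))"
    using underS_mono_cardSuc \<kappa> by (auto simp: relChain_def)
  have "\<exists>i\<in>Field (cardSuc \<kappa>). j \<in> underS (cardSuc \<kappa>) i" if "j \<in> Field (cardSuc \<kappa>)" for j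
    using infinite_Card_order_limit[of "cardSuc \<kappa>" j] Cinfinite_cardSuc[OF \<kappa>] that
    by (auto simp: underS_def cinfinite_def)
  then show "J \<subseteq> (\<Union>i\<in>Field (cardSuc \<kappa>). underS (cardSuc \<kappa>) i)"
    using J by blast
qed (fact J)

text \<open>\<open>H\<close> is the union of a chain indexed by \<open>cardSuc \<kappa>\<close>. By
  regularity a small subset of \<open>H\<close> lies in one stage, and later stages absorb its image
  under \<open>\<Phi>\<close>. Stages stay small because a set of size
  \<open>ctwo ^c \<kappa>\<close> has no more small subsets than that.\<close>

lemma closing_off:
  assumes \<kappa>: "Cinfinite \<kappa>" and p: "p \<in> M"
    and \<Phi>: "\<And>S. S \<in> small_subsets \<kappa> M \<Longrightarrow> \<Phi> S \<subseteq> M \<and> |\<Phi> S| \<le>o ctwo ^c \<kappa>"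
  shows "\<exists>H \<subseteq> M. p \<in> H \<and> |H| \<le>o ctwo ^c \<kappa> \<and> (\<forall>S\<in>small_subsets \<kappa> H. \<Phi> S \<subseteq> H)"
proof -
  let ?r = "cardSuc \<kappa>"
  have co: "Card_order \<kappa>" and c2: "Cinfinite (ctwo ^c \<kappa>)"
    using \<kappa> Cinfinite_ctwo_cexp by auto
  have wo: "Well_order ?r"
    using co by (rule Well_order_cardSuc)
  then have wf: "wf (?r - Id)"
    by (simp add: well_order_on_def)
  obtain F where F: "F i = insert p (\<Union>N\<in>F ` underS ?r i. \<Union>(\<Phi> ` small_subsets \<kappa> N))" for i
    using underS_recursion[OF wo, of "\<lambda>\<N>. insert p (\<Union>N\<in>\<N>. \<Union>(\<Phi> ` small_subsets \<kappa> N))"]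
    by blast
  have size: "i \<in> Field ?r \<Longrightarrow> F i \<subseteq> M \<and> |F i| \<le>o ctwo ^c \<kappa>" for i
  proof (induction i rule: wf_induct_rule[OF wf])
    case (1 i)
    have IH: "F j \<subseteq> M" "|F j| \<le>o ctwo ^c \<kappa>" if "j \<in> underS ?r i" for j
      using 1 that by (auto simp: underS_def intro: FieldI1)
    have sub: "small_subsets \<kappa> (F j) \<subseteq> small_subsets \<kappa> M" if "j \<in> underS ?r i" for j
      using IH(1)[OF that] by (auto simp: small_subsets_def)
    have "|\<Union>(\<Phi> ` small_subsets \<kappa> (F j))| \<le>o ctwo ^c \<kappa>" if "j \<in> underS ?r i" for j
      using sub[OF that] \<Phi> by (intro UNION_Cinfinite_bound card_of_small_subsets \<kappa> c2 IH that) blast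
    moreover have "|underS ?r i| \<le>o ctwo ^c \<kappa>"
      using underS_cardSuc[OF \<kappa>] 1 ordLeq_ctwo_cexp[OF co] by blast
    ultimately have "|\<Union>j\<in>underS ?r i. \<Union>(\<Phi> ` small_subsets \<kappa> (F j))| \<le>o ctwo ^c \<kappa>"
      by (intro UNION_Cinfinite_bound c2) blast+
    then have "|{p} \<union> (\<Union>j\<in>underS ?r i. \<Union>(\<Phi> ` small_subsets \<kappa> (F j)))| \<le>o ctwo ^c \<kappa>"
      by (intro Un_Cinfinite_bound c2 card_of_singleton_ordLeq)
    moreover have "F i = {p} \<union> (\<Union>j\<in>underS ?r i. \<Union>(\<Phi> ` small_subsets \<kappa> (F j)))"
      by (subst F) simp
    moreover have "{p} \<union> (\<Union>j\<in>underS ?r i. \<Union>(\<Phi> ` small_subsets \<kappa> (F j))) \<subseteq> M"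
      using p sub \<Phi> by blast
    ultimately show ?case
      by simp
  qed
  have mono: "relChain ?r F"
    unfolding relChain_def
  proof (intro allI impI)
    fix i j assume "(i, j) \<in> ?r"
    then show "F i \<subseteq> F j"
      using underS_mono_cardSuc[OF co] by (subst (1 2) F) blast
  qed
  let ?H = "\<Union>i\<in>Field ?r. F i"
  have ne: "Field ?r \<noteq> {}"
    using Cinfinite_cardSuc[OF \<kappa>] by (auto simp: cinfinite_def)
  have "\<Phi> S \<subseteq> ?H" if "S \<in> small_subsets \<kappa> ?H" for S
  proof -
    have "S \<subseteq> ?H" "|S| \<le>o \<kappa>"
      using that by (simp_all add: small_subsets_def)
    then obtain i where i: "i \<in> Field ?r" "S \<subseteq> F i"
      using cardSuc_UNION_Cinfinite[OF \<kappa> mono] by meson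
    \<comment> \<open>Stage \<open>i\<close> contains \<open>S\<close>, but \<open>\<Phi> S\<close>
      is added only at stages strictly above \<open>i\<close>.\<close>
    obtain j where j: "j \<in> Field ?r" "i \<in> underS ?r j"
      using cardSuc_bounded[OF \<kappa> _ card_of_singleton_ordLeq[OF \<kappa>]] i(1)
      by (metis empty_subsetI insert_subset)
    have "S \<in> small_subsets \<kappa> (F i)"
      using that i by (auto simp: small_subsets_def)
    then have "\<Phi> S \<subseteq> F j"
      using j by (subst F) blast
    then show ?thesis
      using j by blast
  qed
  moreover have "p \<in> F i" for i
    by (subst F) simp
  then have "p \<in> ?H"
    using ne by blast
  \<comment> \<open>The chain is not too long: Cantor's theorem puts \<open>ctwo ^c \<kappa>\<close>
    above \<open>\<kappa>\<close>, hence at or above its successor.\<close>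
  moreover have "|Field ?r| \<le>o ctwo ^c \<kappa>"
    by (rule ordIso_ordLeq_trans[OF card_of_Field_ordIso[OF cardSuc_Card_order[OF co]]])
      (intro cardSuc_least co Card_order_cexp ordLess_ctwo_cexp)
  then have "|?H| \<le>o ctwo ^c \<kappa>"
    using size by (intro UNION_Cinfinite_bound c2) blast+
  moreover have "?H \<subseteq> M"
    using size by blast
  ultimately show ?thesis
    by blast
qed

section \<open>Weak Lindeloef degree of closed sets\<close>

text \<open>Pick one index for each member of the local base; these at most \<open>\<kappa>\<close>
  indices have a common bound.\<close>

lemma closure_of_union_cardSuc:
  assumes \<kappa>: "Cinfinite \<kappa>" and \<B>: "local_base X p \<B>" "|\<B>| \<le>o \<kappa>"
    and p: "p \<in> X closure_of (q ` Field (cardSuc \<kappa>))"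
  shows "\<exists>i\<in>Field (cardSuc \<kappa>). p \<in> X closure_of (q ` underS (cardSuc \<kappa>) i)"
proof -
  have "\<forall>B\<in>\<B>. \<exists>j\<in>Field (cardSuc \<kappa>). q j \<in> B"
    using \<B>(1) p unfolding local_base_def in_closure_of by blast
  then obtain j where j: "\<And>B. B \<in> \<B> \<Longrightarrow> j B \<in> Field (cardSuc \<kappa>) \<and> q (j B) \<in> B"
    by metis
  obtain i where i: "i \<in> Field (cardSuc \<kappa>)" "j ` \<B> \<subseteq> underS (cardSuc \<kappa>) i"
    using cardSuc_bounded[OF \<kappa>, of "j ` \<B>"] j card_of_image_ordLeq[OF \<B>(2)] by blast
  have "p \<in> X closure_of (q ` underS (cardSuc \<kappa>) i)"
    unfolding in_closure_of
  proof (intro conjI allI impI)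
    show "p \<in> topspace X"
      using p by (simp add: in_closure_of)
    fix T assume "p \<in> T \<and> openin X T"
    then obtain B where "B \<in> \<B>" "B \<subseteq> T"
      using \<B>(1) by (auto simp: local_base_def)
    then show "\<exists>y. y \<in> q ` underS (cardSuc \<kappa>) i \<and> y \<in> T"
      using i j by blast
  qed
  with i show ?thesis
    by blast
qed

lemma Lindelof_subtopology_indexed:
  assumes "Lindelof_space (subtopology X S)" "S \<subseteq> topspace X"
    and "\<And>i. i \<in> I \<Longrightarrow> openin X (V i)" "S \<subseteq> (\<Union>i\<in>I. V i)"
  shows "\<exists>C. countable C \<and> C \<subseteq> I \<and> S \<subseteq> (\<Union>i\<in>C. V i)"
proof -
  have "(\<forall>U\<in>V ` I. openin X U) \<and> S \<subseteq> \<Union>(V ` I)"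
    using assms(3,4) by simp
  then obtain \<V> where "countable \<V>" "\<V> \<subseteq> V ` I" "S \<subseteq> \<Union>\<V>"
    using assms(1) unfolding Lindelof_space_subtopology_subset[OF assms(2)] by meson
  then show ?thesis
    by (metis countable_subset_image)
qed

text \<open>Closedness of \<open>H\<close> keeps the closures of the strongly discrete sets formed
  in the proof inside \<open>H\<close>, where \<open>V\<close> covers them.\<close>

lemma SDL_weakly_Lindelof:
  fixes \<kappa> :: "'k rel"
  assumes SDL: "SDL_space X" and char: "character_bound X \<kappa>" and H: "closedin X H"
    and V: "\<And>x. x \<in> H \<Longrightarrow> openin X (V x) \<and> x \<in> V x"
  shows "\<exists>A\<subseteq>H. |A| \<le>o \<kappa> \<and> H \<subseteq> X closure_of (\<Union>x\<in>A. V x)"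
proof (rule ccontr)
  assume contra: "\<not> ?thesis"
  let ?r = "cardSuc \<kappa>"
  have \<kappa>: "Cinfinite \<kappa>"
    using char by (simp add: character_bound_def)
  then have co: "Card_order \<kappa>"
    by simp
  have wo: "Well_order ?r"
    using co by (rule Well_order_cardSuc)
  then have wf: "wf (?r - Id)"
    by (simp add: well_order_on_def)
  have H_sub: "H \<subseteq> topspace X"
    using H closedin_subset by blast
  have "\<exists>q. \<forall>A. A \<subseteq> H \<and> |A| \<le>o \<kappa> \<longrightarrow> q A \<in> H - X closure_of (\<Union>x\<in>A. V x)"
    using contra by (intro choice) blast
  then obtain q where q: "\<And>A. A \<subseteq> H \<Longrightarrow> |A| \<le>o \<kappa> \<Longrightarrow> q A \<in> H - X closure_of (\<Union>x\<in>A. V x)"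
    by blast
  have "\<exists>C. countable C \<and> C \<subseteq> H \<and> X closure_of D \<subseteq> (\<Union>x\<in>C. V x)"
    if D: "strongly_discrete X D" "D \<subseteq> H" for D
  proof -
    have cl: "X closure_of D \<subseteq> H"
      using D H by (simp add: closure_of_minimal)
    have "Lindelof_space (subtopology X (X closure_of D))"
      using SDL D by (simp add: SDL_space_def)
    moreover have "X closure_of D \<subseteq> (\<Union>x\<in>H. V x)"
      using V cl by blast
    ultimately show ?thesis
      using Lindelof_subtopology_indexed[of X "X closure_of D" H V] V closure_of_subset_topspace
      by metis
  qed
  then obtain C where C: "\<And>D. strongly_discrete X D \<Longrightarrow> D \<subseteq> H \<Longrightarrow>
      countable (C D) \<and> C D \<subseteq> H \<and> X closure_of D \<subseteq> (\<Union>x\<in>C D. V x)"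
    by metis
  \<comment> \<open>Values are pairs of a chosen point and the index set \<open>A\<close> it has to
    escape; \<open>fst\<close> and \<open>snd\<close> recover the earlier points and index
    sets.\<close>
  define step where "step I = (let A = \<Union>(snd ` I) \<union> fst ` I \<union> C (fst ` I) in (q A, A))" for I
  obtain F where F: "F i = step (F ` underS ?r i)" for i
    using underS_recursion[OF wo] by blast
  define x where "x i = fst (F i)" for i
  define A where "A i = snd (F i)" for i
  \<comment> \<open>The removed closure contains \<open>V (x j)\<close> for every earlier
    \<open>j\<close>, which makes these neighbourhoods pairwise disjoint.\<close>
  define N where "N i = V (x i) - X closure_of (\<Union>y\<in>A i. V y)" for i
  have A: "A i = (\<Union>j\<in>underS ?r i. A j) \<union> x ` underS ?r i \<union> C (x ` underS ?r i)" for i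
    unfolding A_def x_def by (subst F) (simp add: step_def Let_def image_image)
  have x: "x i = q (A i)" for i
    unfolding A_def x_def by (subst (1 2) F) (simp add: step_def Let_def)
  have A_mono: "A j \<subseteq> A i" if "j \<in> underS ?r i" for i j
    using that by (subst A[of i]) blast
  have N: "openin X (N i) \<and> x i \<in> N i" if "A i \<subseteq> H" "|A i| \<le>o \<kappa>" for i
  proof -
    have "x i \<in> H" "x i \<notin> X closure_of (\<Union>y\<in>A i. V y)"
      using q[OF that] by (simp_all add: x)
    moreover from this have "openin X (V (x i))" "x i \<in> V (x i)"
      using V by blast+
    ultimately show ?thesis
      unfolding N_def by (simp add: openin_diff)
  qed
  have N_disj: "N j \<inter> N i = {}" if ji: "j \<in> underS ?r i" and Ai: "A i \<subseteq> H" for i j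
  proof -
    have "x j \<in> A i"
      using ji by (subst A) blast
    moreover have "(\<Union>y\<in>A i. V y) \<subseteq> X closure_of (\<Union>y\<in>A i. V y)"
      using V Ai by (intro closure_of_subset) (blast dest: openin_subset)
    ultimately show ?thesis
      unfolding N_def by blast
  qed
  have sd: "strongly_discrete X (x ` J)"
    if J: "J \<subseteq> Field ?r" "\<And>j. j \<in> J \<Longrightarrow> A j \<subseteq> H \<and> |A j| \<le>o \<kappa>" for J
  proof -
    have disj: "N i \<inter> N j = {}" if "i \<in> J" "j \<in> J" "i \<noteq> j" for i j
      using underS_linear_cardSuc[OF co, of i j] N_disj J that by blast
    have inj: "inj_on x J"
      using disj N J by (intro inj_onI) (metis disjoint_iff)
    have "x ` J \<subseteq> topspace X"
      using q J H_sub unfolding x by blast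
    \<comment> \<open>The neighbourhoods are indexed by stages; \<open>inv_into\<close> reindexes
      them by points.\<close>
    moreover have "openin X (N (inv_into J x y)) \<and> y \<in> N (inv_into J x y)" if "y \<in> x ` J" for y
      using that N J by (metis f_inv_into_f inv_into_into)
    moreover have "N (inv_into J x y) \<inter> N (inv_into J x z) = {}"
      if "y \<in> x ` J" "z \<in> x ` J" "y \<noteq> z" for y z
      using that disj by (metis f_inv_into_f inv_into_into)
    ultimately show ?thesis
      unfolding strongly_discrete_def by (intro conjI exI[of _ "N \<circ> inv_into J x"]) auto
  qed
  have xH: "x i \<in> H" if "A i \<subseteq> H" "|A i| \<le>o \<kappa>" for i
    using q[OF that] x by simp
  \<comment> \<open>The choices made by \<open>q\<close> and \<open>C\<close> are meaningful only
    under these bounds. At stage \<open>i\<close> the induction hypothesis makes the earlier points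
    strongly discrete, so \<open>C\<close> adds only countably many points.\<close>
  have inv: "i \<in> Field ?r \<Longrightarrow> A i \<subseteq> H \<and> |A i| \<le>o \<kappa>" for i
  proof (induction i rule: wf_induct_rule[OF wf])
    case (1 i)
    have sub: "underS ?r i \<subseteq> Field ?r"
      by (auto simp: underS_def intro: FieldI1)
    have IH: "A j \<subseteq> H \<and> |A j| \<le>o \<kappa>" if "j \<in> underS ?r i" for j
      using 1 that sub by (auto simp: underS_def)
    have us: "|underS ?r i| \<le>o \<kappa>"
      using underS_cardSuc[OF \<kappa>] 1 by blast
    have D: "strongly_discrete X (x ` underS ?r i)" "x ` underS ?r i \<subseteq> H"
      using sd[OF sub] IH xH by blast+
    have "|\<Union>j\<in>underS ?r i. A j| \<le>o \<kappa>"
      using IH by (intro UNION_Cinfinite_bound us \<kappa>) blast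
    moreover have "|C (x ` underS ?r i)| \<le>o \<kappa>"
      using C[OF D] card_of_countable_ordLeq[OF _ \<kappa>] by blast
    ultimately have "|A i| \<le>o \<kappa>"
      by (subst A) (intro Un_Cinfinite_bound \<kappa> card_of_image_ordLeq us)
    moreover have "A i \<subseteq> H"
      using IH C[OF D] D by (subst A) blast
    ultimately show ?case
      by blast
  qed
  define W where "W i = (\<Union>y\<in>A i. V y)" for i
  let ?D = "x ` Field ?r"
  have D: "strongly_discrete X ?D" "?D \<subseteq> H"
    using sd[of "Field ?r"] inv xH by blast+
  \<comment> \<open>A point of the closure already lies in the closure of an initial segment, which
    the \<open>C\<close> part of some \<open>A i\<close> covers.\<close>
  have "X closure_of ?D \<subseteq> (\<Union>i\<in>Field ?r. W i)"
  proof
    fix p assume p: "p \<in> X closure_of ?D"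
    then have "p \<in> topspace X"
      by (simp add: in_closure_of)
    then obtain \<B> where "local_base X p \<B>" "|\<B>| \<le>o \<kappa>"
      using char by (auto simp: character_bound_def)
    then obtain i where i: "i \<in> Field ?r" "p \<in> X closure_of (x ` underS ?r i)"
      using closure_of_union_cardSuc[OF \<kappa> _ _ p] by blast
    have sub: "underS ?r i \<subseteq> Field ?r"
      by (auto simp: underS_def intro: FieldI1)
    have "p \<in> (\<Union>y\<in>C (x ` underS ?r i). V y)"
      using C[OF sd[OF sub]] i D(2) sub inv by blast
    then have "p \<in> W i"
      unfolding W_def by (subst A) blast
    with i show "p \<in> (\<Union>i\<in>Field ?r. W i)"
      by blast
  qed
  moreover have W_open: "openin X (W i)" if "i \<in> Field ?r" for i
    using V inv[OF that] unfolding W_def by blast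
  moreover have "Lindelof_space (subtopology X (X closure_of ?D))"
    using SDL D by (simp add: SDL_space_def)
  ultimately obtain J where J: "countable J" "J \<subseteq> Field ?r" "X closure_of ?D \<subseteq> (\<Union>j\<in>J. W j)"
    using Lindelof_subtopology_indexed[of X "X closure_of ?D" "Field ?r" W] closure_of_subset_topspace
    by metis
  \<comment> \<open>A stage above the countable set \<open>J\<close>: since the \<open>W j\<close>
    increase, \<open>W i\<close> contains the whole closure, including \<open>x i\<close>, which was
    chosen outside it.\<close>
  obtain i where i: "i \<in> Field ?r" "J \<subseteq> underS ?r i"
    using cardSuc_bounded[OF \<kappa> J(2) card_of_countable_ordLeq[OF J(1) \<kappa>]] by blast
  have "x i \<in> X closure_of ?D"
    using i D H_sub closure_of_subset[of ?D X] by blast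
  then obtain j where j: "j \<in> J" "x i \<in> W j"
    using J(3) by blast
  have "x i \<in> W i"
    using A_mono[of j i] i j unfolding W_def by blast
  moreover have "W i \<subseteq> X closure_of (W i)"
    using W_open[OF i(1)] by (simp add: closure_of_subset openin_subset)
  moreover have "x i \<notin> X closure_of (W i)"
    using q[of "A i"] inv[OF i(1)] unfolding x W_def by blast
  ultimately show False
    by blast
qed

section \<open>The \<open>\<theta>\<close>-closure\<close>

definition theta_closure :: "'a topology \<Rightarrow> 'a set \<Rightarrow> 'a set" where
  "theta_closure X S =
     {x \<in> topspace X. \<forall>U. openin X U \<and> x \<in> U \<longrightarrow> X closure_of U \<inter> S \<noteq> {}}"

text \<open>Shows that a set containing its own \<open>\<theta>\<close>-closure is closed.\<close>

lemma closure_subset_theta_closure: "X closure_of S \<subseteq> theta_closure X S"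
proof
  fix x assume x: "x \<in> X closure_of S"
  have "X closure_of U \<inter> S \<noteq> {}" if "openin X U" "x \<in> U" for U
    using x that closure_of_subset[OF openin_subset, of X U] by (auto simp: in_closure_of)
  with x show "x \<in> theta_closure X S"
    by (auto simp: theta_closure_def in_closure_of)
qed

text \<open>
  In a Urysohn space a point \<open>x\<close> of the \<open>\<theta>\<close>-closure of \<open>S\<close> is determined by the traces on \<open>S\<close> of the
  closures of its basic neighbourhoods: any two traces of the same point meet.
\<close>

lemma card_of_theta_closure:
  assumes Ury: "Urysohn_space X" and \<kappa>: "Cinfinite \<kappa>" and S: "|S| \<le>o \<kappa>"
    and \<B>: "\<And>x. x \<in> topspace X \<Longrightarrow> local_base X x (\<B> x) \<and> |\<B> x| \<le>o \<kappa>"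
  shows "|theta_closure X S| \<le>o ctwo ^c \<kappa>"
proof -
  define T where "T x = (\<lambda>B. X closure_of B \<inter> S) ` \<B> x" for x
  have \<B>_ne: "\<B> x \<noteq> {}" if "x \<in> topspace X" for x
    using \<B>[OF that] that unfolding local_base_def by blast
  have "inj_on T (theta_closure X S)"
  proof (rule inj_onI, rule ccontr)
    fix x y assume x: "x \<in> theta_closure X S" and y: "y \<in> theta_closure X S"
      and eq: "T x = T y" and "x \<noteq> y"
    have xy: "x \<in> topspace X" "y \<in> topspace X"
      using x y by (auto simp: theta_closure_def)
    then obtain U V where UV: "openin X U" "openin X V" "x \<in> U" "y \<in> V"
      "X closure_of U \<inter> X closure_of V = {}"
      using Ury \<open>x \<noteq> y\<close> unfolding Urysohn_space_def by meson
    obtain B where B: "B \<in> \<B> x" "B \<subseteq> U"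
      using \<B>[OF xy(1)] UV unfolding local_base_def by blast
    then obtain B' where B': "B' \<in> \<B> y" "X closure_of B \<inter> S = X closure_of B' \<inter> S"
      using eq unfolding T_def by blast
    \<comment> \<open>Intersecting with \<open>V\<close> yields a point of the trace of
      \<open>B'\<close>, which is also the trace of \<open>B\<close>, inside the closure of
      \<open>V\<close>; it then lies in both disjoint closures.\<close>
    have "openin X (B' \<inter> V)" "y \<in> B' \<inter> V"
      using \<B>[OF xy(2)] B' UV unfolding local_base_def by blast+
    then obtain s where s: "s \<in> X closure_of (B' \<inter> V)" "s \<in> S"
      using y unfolding theta_closure_def by blast
    then have "s \<in> X closure_of B'" "s \<in> X closure_of V"
      by (meson closure_of_mono inf_le1 inf_le2 subsetD)+
    moreover have "s \<in> X closure_of U"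
      using calculation s(2) B' closure_of_mono[OF B(2), of X] by blast
    ultimately show False
      using UV by blast
  qed
  \<comment> \<open>The inclusion is proved for all points of \<open>X\<close>, whose traces may be
    empty; \<open>insert {}\<close> admits the empty trace.\<close>
  moreover have "T ` theta_closure X S \<subseteq> small_subsets \<kappa> (insert {} (small_subsets \<kappa> S))"
  proof -
    have "T x \<in> small_subsets \<kappa> (insert {} (small_subsets \<kappa> S))" if "x \<in> topspace X" for x
      using \<B>[OF that] \<B>_ne[OF that] card_of_subset_ordLeq[OF _ S]
      by (auto simp: small_subsets_def T_def intro: card_of_image_ordLeq)
    then show ?thesis
      by (auto simp: theta_closure_def)
  qed
  ultimately have "|theta_closure X S| \<le>o |small_subsets \<kappa> (insert {} (small_subsets \<kappa> S))|"
    using card_of_ordLeq by blast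
  also have "|small_subsets \<kappa> (insert {} (small_subsets \<kappa> S))| \<le>o ctwo ^c \<kappa>"
  proof (rule card_of_small_subsets[OF \<kappa>])
    have "|small_subsets \<kappa> S| \<le>o ctwo ^c \<kappa>"
      using card_of_small_subsets[OF \<kappa>] ordLeq_ctwo_cexp S \<kappa> by blast
    then have "|{{}} \<union> small_subsets \<kappa> S| \<le>o ctwo ^c \<kappa>"
      by (intro Un_Cinfinite_bound Cinfinite_ctwo_cexp card_of_singleton_ordLeq \<kappa>)
    then show "|insert {} (small_subsets \<kappa> S)| \<le>o ctwo ^c \<kappa>"
      by simp
  qed
  finally show ?thesis .
qed

text \<open>Choosing a point of \<open>H\<close> in the closure of each basic neighbourhood of
  \<open>x\<close> gives a small subset of \<open>H\<close> with \<open>x\<close> in its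
  \<open>\<theta>\<close>-closure.\<close>

lemma theta_closed_if_small:
  assumes \<B>: "local_base X x \<B>" "|\<B>| \<le>o \<kappa>" and x: "x \<in> theta_closure X H"
    and H: "\<And>S. S \<in> small_subsets \<kappa> H \<Longrightarrow> theta_closure X S \<subseteq> H"
  shows "x \<in> H"
proof -
  have "\<exists>a. a \<in> X closure_of B \<inter> H" if "B \<in> \<B>" for B
  proof -
    have "openin X B" "x \<in> B"
      using \<B>(1) that by (auto simp: local_base_def)
    then have "X closure_of B \<inter> H \<noteq> {}"
      using x by (simp add: theta_closure_def)
    then show ?thesis
      by blast
  qed
  then obtain a where a: "\<And>B. B \<in> \<B> \<Longrightarrow> a B \<in> X closure_of B \<inter> H"
    by metis
  have xX: "x \<in> topspace X"
    using x by (simp add: theta_closure_def)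
  then have "\<B> \<noteq> {}"
    using \<B>(1) unfolding local_base_def by blast
  moreover have "a ` \<B> \<subseteq> H"
    using a by blast
  ultimately have "a ` \<B> \<in> small_subsets \<kappa> H"
    using card_of_image_ordLeq[OF \<B>(2)] by (simp add: small_subsets_def)
  moreover have "x \<in> theta_closure X (a ` \<B>)"
  proof -
    have "X closure_of U \<inter> a ` \<B> \<noteq> {}" if U: "openin X U" "x \<in> U" for U
    proof -
      obtain B where B: "B \<in> \<B>" "B \<subseteq> U"
        using \<B>(1) U by (auto simp: local_base_def)
      then have "a B \<in> X closure_of U"
        using a[OF B(1)] closure_of_mono[OF B(2), of X] by blast
      with B(1) show ?thesis
        by blast
    qed
    with xX show ?thesis
      by (simp add: theta_closure_def)
  qed
  ultimately show ?thesis
    using H by blast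
qed

section \<open>The cardinality bound\<close>

theorem corollary8:
  fixes X :: "'a topology"
  assumes "Urysohn_space X" and "SDL_space X"
  shows "|topspace X| \<le>o ctwo ^c character X"
proof (cases "topspace X = {}")
  case True
  then show ?thesis
    by (simp add: cexp_def card_of_empty)
next
  case False
  then obtain p where p: "p \<in> topspace X"
    by blast
  define \<kappa> where "\<kappa> = character X"
  have char: "character_bound X \<kappa>"
    unfolding \<kappa>_def by (rule character_bound_character)
  then have \<kappa>: "Cinfinite \<kappa>" and "\<forall>x\<in>topspace X. \<exists>\<B>. local_base X x \<B> \<and> |\<B>| \<le>o \<kappa>"
    by (auto simp: character_bound_def)
  then obtain \<B> where \<B>: "\<And>x. x \<in> topspace X \<Longrightarrow> local_base X x (\<B> x) \<and> |\<B> x| \<le>o \<kappa>"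
    by metis
  \<comment> \<open>If the union is dense, this choice is arbitrary and may leave the space; hence
    the intersection with \<open>topspace X\<close> in \<open>\<Phi>\<close>.\<close>
  define Q where "Q \<C> = (SOME q. q \<in> topspace X - X closure_of \<Union>\<C>)" for \<C>
  define \<Phi> where "\<Phi> S = theta_closure X S \<union>
      (Q ` small_subsets \<kappa> (\<Union>x\<in>S. \<B> x) \<inter> topspace X)" for S
  have "\<Phi> S \<subseteq> topspace X \<and> |\<Phi> S| \<le>o ctwo ^c \<kappa>" if "S \<in> small_subsets \<kappa> (topspace X)" for S
  proof
    show "\<Phi> S \<subseteq> topspace X"
      by (auto simp: \<Phi>_def theta_closure_def)
    have S: "S \<subseteq> topspace X" "|S| \<le>o \<kappa>"
      using that by (auto simp: small_subsets_def)
    then have "|\<Union>x\<in>S. \<B> x| \<le>o \<kappa>"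
      using \<B> by (intro UNION_Cinfinite_bound \<kappa>) blast+
    then have "|small_subsets \<kappa> (\<Union>x\<in>S. \<B> x)| \<le>o ctwo ^c \<kappa>"
      using card_of_small_subsets[OF \<kappa>] ordLeq_ctwo_cexp \<kappa> by blast
    then have "|Q ` small_subsets \<kappa> (\<Union>x\<in>S. \<B> x) \<inter> topspace X| \<le>o ctwo ^c \<kappa>"
      by (intro card_of_subset_ordLeq[OF Int_lower1] card_of_image_ordLeq)
    then show "|\<Phi> S| \<le>o ctwo ^c \<kappa>"
      unfolding \<Phi>_def
      by (intro Un_Cinfinite_bound Cinfinite_ctwo_cexp \<kappa>
          card_of_theta_closure[OF assms(1) \<kappa> S(2) \<B>])
  qed
  then have "\<exists>H\<subseteq>topspace X. p \<in> H \<and> |H| \<le>o ctwo ^c \<kappa> \<and> (\<forall>S\<in>small_subsets \<kappa> H. \<Phi> S \<subseteq> H)"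
    by (rule closing_off[OF \<kappa> p])
  then obtain H where H: "H \<subseteq> topspace X" "p \<in> H" "|H| \<le>o ctwo ^c \<kappa>"
    and closed: "\<And>S. S \<in> small_subsets \<kappa> H \<Longrightarrow> \<Phi> S \<subseteq> H"
    by auto
  have theta: "theta_closure X H \<subseteq> H"
  proof
    fix x assume x: "x \<in> theta_closure X H"
    then have "x \<in> topspace X"
      by (simp add: theta_closure_def)
    then show "x \<in> H"
      using theta_closed_if_small[OF _ _ x, of "\<B> x" \<kappa>] \<B> closed by (auto simp: \<Phi>_def)
  qed
  have "closedin X H"
    using H(1) theta closure_subset_theta_closure[of X H] closure_of_subset_eq[of H X] by blast
  have "topspace X \<subseteq> H"
  proof (rule ccontr)
    assume "\<not> topspace X \<subseteq> H"
    then obtain z where z: "z \<in> topspace X" "z \<notin> theta_closure X H"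
      using theta by blast
    then obtain G where G: "openin X G" "z \<in> G" "X closure_of G \<inter> H = {}"
      by (auto simp: theta_closure_def)
    \<comment> \<open>The complement of the closure of \<open>G\<close> is an open neighbourhood of
      \<open>x\<close>.\<close>
    have "\<exists>V\<in>\<B> x. V \<inter> G = {}" if "x \<in> H" for x
    proof -
      have "openin X (topspace X - X closure_of G)" "x \<in> topspace X - X closure_of G"
        using that G H by auto
      then obtain V where "V \<in> \<B> x" "V \<subseteq> topspace X - X closure_of G"
        using \<B>[of x] that H unfolding local_base_def by blast
      then show ?thesis
        using closure_of_subset[OF openin_subset[OF G(1)]] by blast
    qed
    then obtain V where V: "\<And>x. x \<in> H \<Longrightarrow> V x \<in> \<B> x \<and> V x \<inter> G = {}"
      by metis
    have "openin X (V x) \<and> x \<in> V x" if "x \<in> H" for x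
      using V[OF that] \<B>[of x] that H unfolding local_base_def by blast
    then obtain A where A: "A \<subseteq> H" "|A| \<le>o \<kappa>" "H \<subseteq> X closure_of (\<Union>x\<in>A. V x)"
      using SDL_weakly_Lindelof[OF assms(2) char \<open>closedin X H\<close>] by metis
    \<comment> \<open>Needed for membership in \<open>small_subsets\<close>; the seed point
      \<open>p\<close> of \<open>H\<close> guarantees it.\<close>
    have "A \<noteq> {}"
      using A(3) H(2) by auto
    then have "A \<in> small_subsets \<kappa> H" "V ` A \<in> small_subsets \<kappa> (\<Union>x\<in>A. \<B> x)"
      using A V card_of_image_ordLeq[OF A(2)] by (auto simp: small_subsets_def)
    then have QH: "Q (V ` A) \<in> topspace X \<Longrightarrow> Q (V ` A) \<in> H"
      using closed unfolding \<Phi>_def by blast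
    \<comment> \<open>\<open>G\<close> separates \<open>z\<close> from the union, so
      \<open>Q\<close> makes a genuine choice: a point outside a closure that contains
      \<open>H\<close>, although \<open>H\<close> is closed under \<open>Q\<close>.\<close>
    have "z \<notin> X closure_of (\<Union>x\<in>A. V x)"
      using G V A(1) unfolding in_closure_of by blast
    then have "z \<in> topspace X - X closure_of \<Union>(V ` A)"
      using z(1) by (rule DiffI[rotated])
    then have "Q (V ` A) \<in> topspace X - X closure_of \<Union>(V ` A)"
      unfolding Q_def by (rule someI)
    then show False
      using QH A(3) by blast
  qed
  then have "|topspace X| \<le>o ctwo ^c \<kappa>"
    using card_of_subset_ordLeq H(3) by blast
  then show ?thesis
    by (simp add: \<kappa>_def)
qed

end
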